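(* Let $n,r,k$ be positive integers and let $C_{\boldsymbol{\lambda}}$ be a conjugacy class of the colored permutation group $\mathfrak{S}_{n,r}$. If $C_{\boldsymbol{\lambda}}$ has no cycles of lengths $1,2,\ldots,2k$, then \[\mathbb{E}_{C_{\boldsymbol{\lambda}}}[\mathrm{des}_{n,r}^k]=\mathbb{E}_{\mathfrak{S}_{n,r}}[\mathrm{des}_{n,r}^k]\quad\text{and}\quad \mathbb{E}_{C_{\boldsymbol{\lambda}}}[\mathrm{fmaj}_{n,r}^k]=\mathbb{E}_{\mathfrak{S}_{n,r}}[\mathrm{fmaj}_{n,r}^k].\]
   Context: $\mathfrak{S}_{n,r}=\mathbb{Z}_r\wr\mathfrak{S}_n$ is the set of pairs $(\omega,\tau)$ with $\omega\in\mathfrak{S}_n$ and $\tau:[n]\to\mathbb{Z}_r$ (colors represented by $0,1,\ldots,r-1$), with product $(\omega_1,\tau_1)(\omega_2,\tau_2)=(\omega_1\omega_2,\tau_1\circ\omega_2+\tau_2)$; equivalently $(\omega,\tau)$ is the bijection of $[n]^r=\{i^c: i\in[n],c\in\mathbb{Z}_r\}$ given by $(\omega,\tau)(i^c)=\omega(i)^{\tau(i)+c}$. Order $[n]^r$ by $1^0<2^0<\cdots<n^0<1^1<\cdots<n^1<\cdots<1^{r-1}<\cdots<n^{r-1}$. An index $i\in[n]$ is a descent of $(\omega,\tau)$ if $\omega(i)^{\tau(i)}>\omega(i+1)^{\tau(i+1)}$ in this order, with the convention $\omega(n+1)=n+1$, $\tau(n+1)=0$. $\mathrm{des}_{n,r}$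 is the number of descents, $\mathrm{maj}_{n,r}$ is the sum of the descents lying in $[n-1]$, $\mathrm{col}_{n,r}(\omega,\tau)=\sum_{i=1}^n\tau(i)$ (computed in $\mathbb{Z}$ with $\tau(i)\in\{0,\ldots,r-1\}$), and $\mathrm{fmaj}_{n,r}=r\cdot\mathrm{maj}_{n,r}+\mathrm{col}_{n,r}$. For a cycle $(i_1\,i_2\,\cdots\,i_\ell)$ of $\omega$, its length is $\ell$ and its color is $\sum_h\tau(i_h)\in\mathbb{Z}_r$; the cycle type of $(\omega,\tau)$ is the $r$-tuple of partitions $\boldsymbol{\lambda}=(\lambda^0,\ldots,\lambda^{r-1})$ where $\lambda^j$ lists the lengths of the cycles of color $j$. The conjugacy classes of $\mathfrak{S}_{n,r}$ are exactly the sets $C_{\boldsymbol{\lambda}}$ of elements of a given cycle type; "$C_{\boldsymbol{\lambda}}$ has no cycles of lengths $1,\ldots,m$" means no part of any $\lambda^j$ lies in $\{1,\ldots,m\}$. Expectations over a set are with respect to the uniform distribution on that set. *)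

theory Defs
  imports
    "HOL-Algebra.Group"
    "HOL-Combinatorics.Orbits"
    "HOL-Library.Multiset"
    "HOL-Probability.Probability"
begin

text \<open>
  Colors are represented by \<open>0, ..., r - 1\<close>.  A color function on \<open>{1..n}\<close> is extended by \<open>0\<close>
  to all of \<^typ>\<open>nat\<close>, just as a permutation of \<open>{1..n}\<close> is extended by the identity
  (\<open>permutes\<close>).  In particular the conventions \<open>\<omega> (n + 1) = n + 1\<close> and \<open>\<tau> (n + 1) = 0\<close>
  hold for every element of \<open>colored_perms n r\<close>.
\<close>

type_synonym colored_perm = "(nat \<Rightarrow> nat) \<times> (nat \<Rightarrow> nat)"

definition colored_perms :: "nat \<Rightarrow> nat \<Rightarrow> colored_perm set" where
  "colored_perms n r =
     {(\<omega>, \<tau>). \<omega> permutes {1..n} \<and> (\<forall>i\<in>{1..n}. \<tau> i < r) \<and> (\<forall>i. i \<notin> {1..n} \<longrightarrow> \<tau> i = 0)}"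

definition colored_mult :: "nat \<Rightarrow> colored_perm \<Rightarrow> colored_perm \<Rightarrow> colored_perm" where
  "colored_mult r = (\<lambda>(\<omega>1, \<tau>1) (\<omega>2, \<tau>2). (\<omega>1 \<circ> \<omega>2, \<lambda>i. (\<tau>1 (\<omega>2 i) + \<tau>2 i) mod r))"

definition colored_perm_group :: "nat \<Rightarrow> nat \<Rightarrow> colored_perm monoid" where
  "colored_perm_group n r =
     \<lparr>carrier = colored_perms n r, monoid.mult = colored_mult r, one = (id, \<lambda>_. 0)\<rparr>"

lemma group_colored_perm_group:
  assumes "r > 0"
  shows "group (colored_perm_group n r)"
proof (rule groupI, goal_cases)
  case (1 x y)
  then show ?case
    using assms
    by (auto simp: colored_perm_group_def colored_perms_def colored_mult_def permutes_compose
        permutes_not_in)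
next
  case 2
  then show ?case
    using assms by (auto simp: colored_perm_group_def colored_perms_def permutes_id)
next
  case (3 x y z)
  then show ?case
    by (auto simp: colored_perm_group_def colored_mult_def fun_eq_iff mod_simps add.assoc
        split: prod.splits)
next
  case (4 x)
  then show ?case
    by (auto simp: colored_perm_group_def colored_perms_def colored_mult_def fun_eq_iff)
      (metis mod_less mod_0 atLeastAtMost_iff)
next
  case (5 x)
  then obtain \<omega> \<tau> where x: "x = (\<omega>, \<tau>)" and \<omega>: "\<omega> permutes {1..n}"
    and \<tau>: "\<And>i. i \<in> {1..n} \<Longrightarrow> \<tau> i < r" "\<And>i. i \<notin> {1..n} \<Longrightarrow> \<tau> i = 0"
    by (auto simp: colored_perm_group_def colored_perms_def)
  define y where "y = (inv_into UNIV \<omega>, \<lambda>i. (r - \<tau> (inv_into UNIV \<omega> i)) mod r)"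
  have le: "\<tau> i \<le> r" for i
    using \<tau>[of i] by (cases "i \<in> {1..n}") auto
  have "y \<in> carrier (colored_perm_group n r)"
    using permutes_inv[OF \<omega>] \<tau>(2) assms
    by (auto simp: y_def colored_perm_group_def colored_perms_def permutes_not_in)
  moreover have "y \<otimes>\<^bsub>colored_perm_group n r\<^esub> x = \<one>\<^bsub>colored_perm_group n r\<^esub>"
    using le permutes_inv_o(2)[OF \<omega>] permutes_inverses(2)[OF \<omega>]
    by (auto simp: x y_def colored_perm_group_def colored_mult_def fun_eq_iff mod_simps)
  ultimately show ?case by blast
qed

definition conjugacy_class :: "('a, 'b) monoid_scheme \<Rightarrow> 'a \<Rightarrow> 'a set" where
  "conjugacy_class G x = {g \<otimes>\<^bsub>G\<^esub> x \<otimes>\<^bsub>G\<^esub> inv\<^bsub>G\<^esub> g | g. g \<in> carrier G}"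

definition conjugacy_classes :: "('a, 'b) monoid_scheme \<Rightarrow> 'a set set" where
  "conjugacy_classes G = conjugacy_class G ` carrier G"

text \<open>
  A cycle of \<open>\<omega>\<close> is represented by the set of its elements; fixed points count as cycles of
  length 1.
\<close>

definition cycles :: "nat \<Rightarrow> (nat \<Rightarrow> nat) \<Rightarrow> nat set set" where
  "cycles n \<omega> = Orbits.orbit \<omega> ` {1..n}"

definition cycle_color :: "nat \<Rightarrow> (nat \<Rightarrow> nat) \<Rightarrow> nat set \<Rightarrow> nat" where
  "cycle_color r \<tau> c = (\<Sum>i\<in>c. \<tau> i) mod r"

text \<open>Partitions are multisets of parts; an \<open>r\<close>-tuple of partitions is a list of length \<open>r\<close>.\<close>

definition cycle_type :: "nat \<Rightarrow> nat \<Rightarrow> colored_perm \<Rightarrow> nat multiset list" where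
  "cycle_type n r = (\<lambda>(\<omega>, \<tau>).
     map (\<lambda>j. image_mset card (mset_set {c \<in> cycles n \<omega>. cycle_color r \<tau> c = j})) [0..<r])"

definition cycle_type_class :: "nat \<Rightarrow> nat \<Rightarrow> nat multiset list \<Rightarrow> colored_perm set" where
  "cycle_type_class n r \<Lambda> = {x \<in> colored_perms n r. cycle_type n r x = \<Lambda>}"

text \<open>The pair \<open>(a, c)\<close> stands for the letter \<open>a\<close> with color \<open>c\<close>; colors are compared first.\<close>

definition colored_less :: "nat \<times> nat \<Rightarrow> nat \<times> nat \<Rightarrow> bool" where
  "colored_less = (\<lambda>(a, c) (b, d). c < d \<or> c = d \<and> a < b)"

definition descents :: "nat \<Rightarrow> colored_perm \<Rightarrow> nat set" where
  "descents n = (\<lambda>(\<omega>, \<tau>). {i \<in> {1..n}. colored_less (\<omega> (i + 1), \<tau> (i + 1)) (\<omega> i, \<tau> i)})"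

definition des :: "nat \<Rightarrow> colored_perm \<Rightarrow> nat" where
  "des n x = card (descents n x)"

definition maj :: "nat \<Rightarrow> colored_perm \<Rightarrow> nat" where
  "maj n x = \<Sum>(descents n x \<inter> {1..n - 1})"

definition col :: "nat \<Rightarrow> colored_perm \<Rightarrow> nat" where
  "col n = (\<lambda>(\<omega>, \<tau>). \<Sum>i=1..n. \<tau> i)"

definition fmaj :: "nat \<Rightarrow> nat \<Rightarrow> colored_perm \<Rightarrow> nat" where
  "fmaj n r x = r * maj n x + col n x"

definition uniform_expectation :: "'a set \<Rightarrow> ('a \<Rightarrow> real) \<Rightarrow> real" where
  "uniform_expectation A f = measure_pmf.expectation (pmf_of_set A) f"

end

theory Submission
  imports Defs "HOL-Library.Fun_Lexorder" "HOL-Number_Theory.Cong"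
begin

text \<open>
  Both \<open>des\<close> and \<open>fmaj\<close> are sums of terms that involve only the colors of two adjacent positions
  and whether \<open>\<omega>\<close> ascends there, so their \<open>k\<close>-th powers are combinations of products \<open>h \<tau>\<close> times
  the indicator that \<open>\<omega>\<close> ascends at every position of a set \<open>D\<close>, where \<open>h\<close> depends only on the
  colors on a set \<open>P\<close> of at most \<open>2 k\<close> positions containing \<open>D\<close> and \<open>D + 1\<close>.  Such a product has
  the same mean on the class and on the whole group, for two reasons.

  Colors: since \<open>\<omega>\<close> has no cycle inside \<open>P\<close>, the path of every \<open>i \<in> P\<close> leaves \<open>P\<close>, and
  conjugating by a pure color change summed up along these paths shifts the colors on \<open>P\<close> by any
  prescribed amount.  Hence the colors on \<open>P\<close> are uniform given \<open>\<omega>\<close>.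

  Ascents: \<open>D\<close> cuts \<open>{1..n}\<close> into intervals on which \<open>\<omega>\<close> has to increase.  Among the conjugates of
  \<open>\<omega>\<close> by the permutations that preserve these intervals, exactly one conjugating permutation gives
  a solution, so the probability is the reciprocal of the number of such permutations.  In the
  whole group the same holds with right multiplication in place of conjugation.
\<close>

text \<open>The prefix notation \<open>inv\<close> is taken by the group inverse of HOL-Algebra.\<close>

abbreviation pinv :: "('a \<Rightarrow> 'a) \<Rightarrow> 'a \<Rightarrow> 'a" where
  "pinv \<equiv> inv_into UNIV"

section \<open>Sorting by permutations that preserve blocks\<close>

definition block_perms :: "nat \<Rightarrow> (nat \<Rightarrow> nat) \<Rightarrow> (nat \<Rightarrow> nat) set" where
  "block_perms n b = {y. y permutes {1..n} \<and> (\<forall>i. b (y i) = b i)}"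

text \<open>The only order-preserving bijection from \<open>R\<close> to \<open><\<close> on
  \<open>{1..n}\<close> sends each element to its rank. Since \<open>R\<close> compares values of
  \<open>b\<close> first and \<open>b\<close> is monotone, ranking keeps every element in its fibre
  of \<open>b\<close>.\<close>

lemma ex1_sorting_permutation:
  fixes b :: "nat \<Rightarrow> nat" and R :: "nat \<Rightarrow> nat \<Rightarrow> bool"
  assumes trans: "\<And>i j k. R i j \<Longrightarrow> R j k \<Longrightarrow> R i k" and irrefl: "\<And>i. \<not> R i i"
    and total: "\<And>i j. i \<in> {1..n} \<Longrightarrow> j \<in> {1..n} \<Longrightarrow> i \<noteq> j \<Longrightarrow> R i j \<or> R j i"
    and b: "mono b" "\<And>i j. b i < b j \<Longrightarrow> R i j"
  shows "\<exists>!y. y \<in> block_perms n b \<and> (\<forall>i\<in>{1..n}. \<forall>j\<in>{1..n}. R i j \<longrightarrow> y i < y j)"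
proof -
  let ?A = "{1..n}"
  define below where "below i = {j \<in> ?A. R j i \<or> j = i}" for i
  define y where "y i = (if i \<in> ?A then card (below i) else i)" for i
  have fin [simp]: "finite (below i)" for i
    by (simp add: below_def)
  have less: "y i < y j" if "i \<in> ?A" "j \<in> ?A" "R i j" for i j
  proof -
    have "below i \<subset> below j"
      using that trans irrefl unfolding below_def by blast
    then show ?thesis
      using that psubset_card_mono[OF fin] by (simp add: y_def)
  qed
  have y_in: "y i \<in> ?A" if "i \<in> ?A" for i
  proof -
    have "i \<in> below i" "below i \<subseteq> ?A"
      using that by (auto simp: below_def)
    then show ?thesis
      using that card_mono[of ?A "below i"] by (auto simp: y_def Suc_le_eq card_gt_0_iff)
  qed
  have y_perm: "y permutes ?A"
  proof (rule inj_imp_permutes)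
    show "inj_on y ?A"
      using less total unfolding inj_on_def by (metis less_irrefl)
  qed (use y_in in \<open>auto simp: y_def\<close>)
  \<comment> \<open>Sublevel sets of \<open>b\<close> are initial segments both for \<open>R\<close>
    and for \<open><\<close>, so the rank map can only send one into or over itself; equal
    cardinalities then give equality.\<close>
  have lower: "y ` {j \<in> ?A. b j \<le> v} = {j \<in> ?A. b j \<le> v}" for v
  proof -
    let ?L = "{j \<in> ?A. b j \<le> v}"
    have card: "card (y ` ?L) = card ?L"
      using permutes_inj_on[OF y_perm] by (rule card_image)
    have "?L \<subseteq> y ` ?L \<or> y ` ?L \<subseteq> ?L"
    proof (rule ccontr)
      assume "\<not> ?thesis"
      then obtain p q where p: "p \<in> ?L" "p \<notin> y ` ?L" and q: "q \<in> ?L" "y q \<notin> ?L"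
        by blast
      obtain p' where p': "p' \<in> ?A" "p = y p'"
        using p(1) permutes_image[OF y_perm] by blast
      then have "b q < b p'"
        using p q by (metis (mono_tags, lifting) imageI le_trans mem_Collect_eq not_le)
      then have "y q < p"
        using less[of q p'] b(2) p' q by auto
      then have "b (y q) \<le> b p"
        using b(1) by (simp add: monoD)
      then show False
        using p(1) q y_in by auto
    qed
    moreover have "finite ?L" "finite (y ` ?L)"
      by auto
    ultimately show ?thesis
      using card card_subset_eq[of "y ` ?L" ?L] card_subset_eq[of ?L "y ` ?L"] by argo
  qed
  have "b (y i) = b i" for i
  proof (cases "i \<in> ?A")
    case True
    have "b (y i) \<le> v \<longleftrightarrow> b i \<le> v" for v
    proof -
      have "y i \<in> y ` {j \<in> ?A. b j \<le> v} \<longleftrightarrow> i \<in> {j \<in> ?A. b j \<le> v}"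
        by (rule inj_image_mem_iff[OF permutes_inj[OF y_perm]])
      then show ?thesis
        using True y_in[OF True] unfolding lower by auto
    qed
    then show ?thesis
      by (metis order_antisym order_refl)
  qed (auto simp: y_def)
  with y_perm have "y \<in> block_perms n b"
    by (auto simp: block_perms_def)
  moreover have "z = y" if z_perm: "z permutes ?A" and z: "\<And>i j. i \<in> ?A \<Longrightarrow> j \<in> ?A \<Longrightarrow> R i j \<Longrightarrow> z i < z j"
    for z
  proof
    fix i
    show "z i = y i"
    proof (cases "i \<in> ?A")
      case True
      have "z i \<in> ?A"
        using permutes_in_image[OF z_perm] True by blast
      have eq: "R j i \<or> j = i \<longleftrightarrow> z j \<le> z i" if "j \<in> ?A" for j
      proof (cases "R j i \<or> j = i")
        case True
        then show ?thesis
          using z[of j i] that \<open>i \<in> ?A\<close> by auto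
      next
        case False
        then show ?thesis
          using z[of i j] total[of i j] that \<open>i \<in> ?A\<close> by auto
      qed
      \<comment> \<open>A sorting \<open>z\<close> maps the elements up to \<open>i\<close> onto an
        initial segment, so \<open>z i\<close> has to be the rank of \<open>i\<close>.\<close>
      have "z ` below i = {1..z i}"
      proof
        show "z ` below i \<subseteq> {1..z i}"
        proof
          fix x
          assume "x \<in> z ` below i"
          then obtain j where j: "j \<in> ?A" "R j i \<or> j = i" "x = z j"
            unfolding below_def by blast
          then have "z j \<in> ?A"
            using permutes_in_image[OF z_perm] by blast
          with j eq show "x \<in> {1..z i}"
            by auto
        qed
        show "{1..z i} \<subseteq> z ` below i"
        proof
          fix x
          assume x: "x \<in> {1..z i}"
          with \<open>z i \<in> ?A\<close> have "x \<in> ?A"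
            by auto
          then obtain j where "j \<in> ?A" "x = z j"
            using permutes_image[OF z_perm] by blast
          with x eq have "j \<in> below i"
            unfolding below_def by simp
          with \<open>x = z j\<close> show "x \<in> z ` below i"
            by blast
        qed
      qed
      then have "card (below i) = z i"
        using card_image[OF permutes_inj_on[OF z_perm], of "below i"] by simp
      with True show ?thesis
        by (simp add: y_def)
    next
      case False
      then show ?thesis
        using permutes_not_in[OF z_perm False] unfolding y_def by presburger
    qed
  qed
  ultimately show ?thesis
    using less by (intro ex1I[of _ y]) (auto simp: block_perms_def)
qed

section \<open>Intervals of forced ascents\<close>

definition ascends :: "nat set \<Rightarrow> (nat \<Rightarrow> nat) \<Rightarrow> bool" where
  "ascends D \<omega> \<longleftrightarrow> (\<forall>i\<in>D. \<omega> i < \<omega> (Suc i))"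

text \<open>The fibres of \<open>block D\<close> are the maximal intervals on which \<open>ascends D\<close> imposes increase.\<close>

definition block :: "nat set \<Rightarrow> nat \<Rightarrow> nat" where
  "block D i = card ({..<i} - D)"

lemma mono_block: "mono (block D)"
  unfolding block_def by (intro monoI card_mono) auto

lemma block_Suc: "block D (Suc i) = (if i \<in> D then block D i else Suc (block D i))"
  by (simp add: block_def lessThan_Suc insert_Diff_if)

lemma block_less_imp_less:
  assumes "block D i < block D j"
  shows "i < j"
  using assms mono_block[of D] by (metis monoD not_le)

lemma block_eq_imp_mem:
  assumes "block D i = block D j" "i < j"
  shows "i \<in> D" "j \<in> Suc ` D"
proof -
  show "i \<in> D"
    using assms monoD[OF mono_block[of D], of "Suc i" j] by (auto simp: block_Suc split: if_splits)
  obtain k where k: "j = Suc k" "i \<le> k"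
    using assms(2) by (cases j) auto
  then have "k \<in> D"
    using assms monoD[OF mono_block[of D], of i k] by (auto simp: block_Suc split: if_splits)
  with k show "j \<in> Suc ` D"
    by blast
qed

lemma block_eqD:
  assumes "block D i = block D j" "i \<notin> P" "D \<subseteq> P" "Suc ` D \<subseteq> P"
  shows "i = j"
  using assms block_eq_imp_mem[of D i j] block_eq_imp_mem[of D j i]
  by (metis nat_neq_iff subsetD)

lemma ascends_block:
  assumes "ascends D \<omega>" "block D i = block D j" "i < j"
  shows "\<omega> i < \<omega> j"
  using assms(3,2)
proof (induction j)
  case (Suc j)
  have "j \<in> D"
    using block_eq_imp_mem(2)[OF Suc.prems(2,1)] by auto
  then have "\<omega> j < \<omega> (Suc j)" "block D i = block D j"
    using assms(1) Suc.prems(2) by (auto simp: ascends_def block_Suc)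
  with Suc.prems Suc.IH show ?case
    by (cases "i = j") auto
qed simp

text \<open>Composing with \<open>pinv y\<close> rearranges the values of \<open>\<omega>\<close>
  within each block. The result increases on the blocks exactly when \<open>y\<close> sorts by block
  first and by the value of \<open>\<omega>\<close> second, which is the order
  \<open>R\<close>.\<close>

lemma ex1_ascends_comp:
  assumes \<omega>: "\<omega> permutes {1..n}" and D: "D \<subseteq> {1..n}" "Suc ` D \<subseteq> {1..n}"
  shows "\<exists>!y. y \<in> block_perms n (block D) \<and> ascends D (\<omega> \<circ> pinv y)"
proof -
  let ?A = "{1..n}" and ?b = "block D"
  define R where "R i j \<longleftrightarrow> ?b i < ?b j \<or> ?b i = ?b j \<and> \<omega> i < \<omega> j" for i j
  have "ascends D (\<omega> \<circ> pinv y) \<longleftrightarrow> (\<forall>i\<in>?A. \<forall>j\<in>?A. R i j \<longrightarrow> y i < y j)"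
    if y: "y \<in> block_perms n ?b" for y
  proof -
    have perm: "y permutes ?A" and y_blk: "\<And>i. ?b (y i) = ?b i"
      using y by (auto simp: block_perms_def)
    note inv = permutes_inverses[OF perm]
    show ?thesis
    proof (intro iffI ballI impI)
      fix i j
      assume asc: "ascends D (\<omega> \<circ> pinv y)" and R: "R i j"
      show "y i < y j"
      proof (cases "?b i < ?b j")
        case True
        then show ?thesis
          using block_less_imp_less[of D "y i" "y j"] by (simp add: y_blk)
      next
        case False
        with R have eq: "?b i = ?b j" and less: "\<omega> i < \<omega> j"
          by (auto simp: R_def)
        have "\<not> y j < y i"
          using ascends_block[OF asc, of "y j" "y i"] eq less by (auto simp: y_blk inv)
        moreover have "y i \<noteq> y j"
          using less by (metis inv(2) less_irrefl)
        ultimately show ?thesis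
          by simp
      qed
    next
      assume sorted: "\<forall>i\<in>?A. \<forall>j\<in>?A. R i j \<longrightarrow> y i < y j"
      show "ascends D (\<omega> \<circ> pinv y)"
        unfolding ascends_def
      proof
        fix i
        assume i: "i \<in> D"
        define a a' where "a = pinv y i" and "a' = pinv y (Suc i)"
        have ya: "y a = i" "y a' = Suc i"
          by (simp_all add: a_def a'_def inv)
        have A: "a \<in> ?A" "a' \<in> ?A"
          using D i permutes_in_image[OF permutes_inv[OF perm]] by (auto simp: a_def a'_def)
        have eq: "?b a = ?b a'"
          using i by (metis ya y_blk block_Suc)
        have "\<not> R a' a"
          using sorted A ya by fastforce
        moreover have "\<omega> a \<noteq> \<omega> a'"
          using permutes_inj[OF \<omega>] ya by (metis injD n_not_Suc_n)
        ultimately have "\<omega> a < \<omega> a'"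
          using eq by (auto simp: R_def)
        then show "(\<omega> \<circ> pinv y) i < (\<omega> \<circ> pinv y) (Suc i)"
          by (simp add: a_def a'_def)
      qed
    qed
  qed
  moreover have "\<exists>!y. y \<in> block_perms n ?b \<and> (\<forall>i\<in>?A. \<forall>j\<in>?A. R i j \<longrightarrow> y i < y j)"
  proof (rule ex1_sorting_permutation)
    show "R i j \<or> R j i" if "i \<noteq> j" for i j
      using that permutes_inj[OF \<omega>] unfolding R_def by (metis injD nat_neq_iff)
  qed (auto simp: R_def mono_block)
  ultimately show ?thesis
    by (simp cong: conj_cong)
qed

section \<open>Ascents of conjugates\<close>

text \<open>For a permutation of \<open>{1..n}\<close> this says that no cycle lies inside
  \<open>P\<close>. The form with iterates directly supplies a time at which a path is outside
  \<open>P\<close>.\<close>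

definition leaves :: "nat \<Rightarrow> nat set \<Rightarrow> (nat \<Rightarrow> nat) \<Rightarrow> bool" where
  "leaves n P \<omega> \<longleftrightarrow> (\<forall>i\<in>{1..n}. \<exists>t. (\<omega> ^^ t) i \<notin> P)"

text \<open>
  As in the Gessel--Reutenauer correspondence, label each \<open>i\<close> by the word of blocks visited by
  \<open>i, \<omega> i, \<omega> (\<omega> i), \<dots>\<close>; the conjugate of \<open>\<omega>\<close> is increasing on the blocks if and only if the
  conjugating permutation sorts these words lexicographically.
\<close>

lemma ex1_ascends_conj:
  assumes \<omega>: "\<omega> permutes {1..n}" and P: "P \<subseteq> {1..n}" and D: "D \<subseteq> P" "Suc ` D \<subseteq> P"
    and leaves: "leaves n P \<omega>"
  shows "\<exists>!y. y \<in> block_perms n (block D) \<and> ascends D (y \<circ> \<omega> \<circ> pinv y)"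
proof -
  let ?A = "{1..n}" and ?b = "block D"
  define word where "word i = (\<lambda>t. ?b ((\<omega> ^^ t) i))" for i
  define R where "R i j \<longleftrightarrow> less_fun (word i) (word j)" for i j
  have word_0: "word i 0 = ?b i" and word_Suc: "word i (Suc t) = word (\<omega> i) t" for i t
    by (simp_all add: word_def funpow_swap1)
  have R_block: "R i j" if "?b i < ?b j" for i j
    unfolding R_def less_fun_def by (rule exI[of _ 0]) (simp add: word_0 that)
  \<comment> \<open>Words with equal first letters compare like their tails, and the tail of the
    word of \<open>i\<close> is the word of \<open>\<omega> i\<close>.\<close>
  have R_step: "R i j \<longleftrightarrow> R (\<omega> i) (\<omega> j)" if eq: "?b i = ?b j" for i j
  proof
    assume "R i j"
    then obtain k where k: "word i k < word j k" "\<forall>t<k. word i t = word j t"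
      unfolding R_def less_fun_def by blast
    then obtain k' where "k = Suc k'"
      using eq k(1) by (cases k) (auto simp: word_0)
    with k show "R (\<omega> i) (\<omega> j)"
      unfolding R_def less_fun_def by (intro exI[of _ k']) (auto simp flip: word_Suc)
  next
    assume "R (\<omega> i) (\<omega> j)"
    then obtain k where k: "word i (Suc k) < word j (Suc k)"
      "\<forall>t<k. word i (Suc t) = word j (Suc t)"
      unfolding R_def less_fun_def word_Suc by blast
    then have "word i t = word j t" if "t < Suc k" for t
      using that eq by (cases t) (auto simp: word_0)
    with k(1) show "R i j"
      unfolding R_def less_fun_def by blast
  qed
  have total: "R i j \<or> R j i" if i: "i \<in> ?A" "i \<noteq> j" for i j
  proof -
    \<comment> \<open>Outside \<open>P\<close> blocks are singletons, so at time \<open>t\<close>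
      the two distinct paths are in different blocks and the words differ.\<close>
    obtain t where "(\<omega> ^^ t) i \<notin> P"
      using leaves i unfolding leaves_def by blast
    moreover have "(\<omega> ^^ t) i \<noteq> (\<omega> ^^ t) j"
      using inj_fn[OF permutes_inj[OF \<omega>]] i(2) by (metis injD)
    ultimately have "word i t \<noteq> word j t"
      using block_eqD D unfolding word_def by blast
    then have ex: "\<exists>t. word i t \<noteq> word j t"
      by blast
    define k where "k = (LEAST t. word i t \<noteq> word j t)"
    have "word i k \<noteq> word j k" and "\<And>t. t < k \<Longrightarrow> word i t = word j t"
      unfolding k_def by (rule LeastI_ex[OF ex], use not_less_Least in blast)
    then show ?thesis
      unfolding R_def less_fun_def by (metis nat_neq_iff)
  qed
  have "ascends D (y \<circ> \<omega> \<circ> pinv y) \<longleftrightarrow> (\<forall>i\<in>?A. \<forall>j\<in>?A. R i j \<longrightarrow> y i < y j)"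
    if y: "y \<in> block_perms n ?b" for y
  proof -
    have perm: "y permutes ?A" and y_blk: "\<And>i. ?b (y i) = ?b i"
      using y by (auto simp: block_perms_def)
    note inv = permutes_inverses[OF perm]
    have less_block: "y i < y j" if "?b i < ?b j" for i j
      using block_less_imp_less[of D "y i" "y j"] that by (simp add: y_blk)
    show ?thesis
    proof (intro iffI ballI impI)
      assume asc: "ascends D (y \<circ> \<omega> \<circ> pinv y)"
      \<comment> \<open>Induction on the first place where the words differ. The conjugate sends
        \<open>y i\<close> to \<open>y (\<omega> i)\<close> and increases on blocks, so within a
        block the order of the images forces that of the arguments.\<close>
      have "y i < y j" if "word i k < word j k" "\<And>t. t < k \<Longrightarrow> word i t = word j t" for i j k
        using that
      proof (induction k arbitrary: i j)
        case 0
        then show ?case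
          by (simp add: less_block word_0)
      next
        case (Suc k)
        have eq: "?b i = ?b j"
          using Suc.prems(2)[of 0] by (simp add: word_0)
        have less: "y (\<omega> i) < y (\<omega> j)"
          using Suc.prems by (intro Suc.IH) (auto simp flip: word_Suc)
        have "\<not> y j < y i"
          using ascends_block[OF asc, of "y j" "y i"] eq less by (auto simp: y_blk inv)
        moreover have "y i \<noteq> y j"
          using less by (metis inv(2) less_irrefl)
        ultimately show ?case
          by simp
      qed
      then show "y i < y j" if "R i j" for i j
        using that unfolding R_def less_fun_def by blast
    next
      assume sorted: "\<forall>i\<in>?A. \<forall>j\<in>?A. R i j \<longrightarrow> y i < y j"
      show "ascends D (y \<circ> \<omega> \<circ> pinv y)"
        unfolding ascends_def
      proof
        fix i
        assume i: "i \<in> D"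
        define a a' where "a = pinv y i" and "a' = pinv y (Suc i)"
        have ya: "y a = i" "y a' = Suc i"
          by (simp_all add: a_def a'_def inv)
        have A: "a \<in> ?A" "a' \<in> ?A"
          unfolding a_def a'_def permutes_in_image[OF permutes_inv[OF perm]] using P D i by blast+
        have eq: "?b a = ?b a'"
          using i by (metis ya y_blk block_Suc)
        have "\<not> R a' a"
          using sorted A ya by fastforce
        moreover have "a \<noteq> a'"
          using ya by (metis n_not_Suc_n)
        ultimately have "R a a'"
          using total[OF A(1)] by blast
        then have "y (\<omega> a) < y (\<omega> a')"
          using sorted A permutes_in_image[OF \<omega>] R_step[OF eq] by blast
        then show "(y \<circ> \<omega> \<circ> pinv y) i < (y \<circ> \<omega> \<circ> pinv y) (Suc i)"
          by (simp add: a_def a'_def)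
      qed
    qed
  qed
  moreover have "\<exists>!y. y \<in> block_perms n ?b \<and> (\<forall>i\<in>?A. \<forall>j\<in>?A. R i j \<longrightarrow> y i < y j)"
  proof (rule ex1_sorting_permutation)
    show "R i j \<Longrightarrow> R j k \<Longrightarrow> R i k" for i j k
      unfolding R_def by (rule less_fun_trans)
  qed (use total R_block in \<open>auto simp: R_def less_fun_irrefl mono_block\<close>)
  ultimately show ?thesis
    by (simp cong: conj_cong)
qed

section \<open>Averaging over colors\<close>

lemma finite_colored_perms: "finite (colored_perms n r)"
proof (rule finite_subset)
  let ?T = "{\<tau>. \<forall>i. (i \<in> {1..n} \<longrightarrow> \<tau> i \<in> {..<r}) \<and> (i \<notin> {1..n} \<longrightarrow> \<tau> i = 0)}"
  show "colored_perms n r \<subseteq> {\<omega>. \<omega> permutes {1..n}} \<times> ?T"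
    by (auto simp: colored_perms_def)
  show "finite ({\<omega>. \<omega> permutes {1..n}} \<times> ?T)"
    by (intro finite_cartesian_product finite_permutations finite_set_of_finite_funs) auto
qed

lemma finite_block_perms: "finite (block_perms n b)"
  by (rule finite_subset[OF _ finite_permutations[of "{1..n}"]]) (auto simp: block_perms_def)

text \<open>For finite \<open>X\<close> this expresses that the colors on \<open>P\<close> are
  uniform given \<open>\<omega>\<close>. The map \<open>\<phi>\<close> may also change colors
  outside \<open>P\<close>, as conjugation does.\<close>

definition shifts_colors :: "nat \<Rightarrow> nat set \<Rightarrow> colored_perm set \<Rightarrow> bool" where
  "shifts_colors r P X \<longleftrightarrow> (\<forall>\<omega>. \<forall>\<delta> \<in> P \<rightarrow>\<^sub>E {..<r}. \<exists>\<phi>.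
     bij_betw \<phi> {\<tau>. (\<omega>, \<tau>) \<in> X} {\<tau>. (\<omega>, \<tau>) \<in> X} \<and>
     (\<forall>\<tau>. (\<omega>, \<tau>) \<in> X \<longrightarrow> (\<forall>i\<in>P. \<phi> \<tau> i = (\<tau> i + \<delta> i) mod r)))"

lemma add_mod_cancel:
  fixes c x y r :: nat
  assumes "x < r" "y < r" "(c + x) mod r = (c + y) mod r"
  shows "x = y"
  using assms cong_add_lcancel_nat[of c x y r] by (simp add: cong_def)

definition depends_on :: "'a set \<Rightarrow> (('a \<Rightarrow> 'b) \<Rightarrow> 'c) \<Rightarrow> bool" where
  "depends_on P h \<longleftrightarrow> (\<forall>f g. (\<forall>i\<in>P. f i = g i) \<longrightarrow> h f = h g)"

lemma depends_onD: "depends_on P h \<Longrightarrow> (\<And>i. i \<in> P \<Longrightarrow> f i = g i) \<Longrightarrow> h f = h g"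
  by (simp add: depends_on_def)

text \<open>Adding a fixed \<open>\<tau>\<close> modulo \<open>r\<close> permutes the color vectors
  on \<open>P\<close>.\<close>

lemma sum_shift_colors:
  fixes h :: "(nat \<Rightarrow> nat) \<Rightarrow> real"
  assumes local: "depends_on P h" and "finite P"
  shows "(\<Sum>\<delta>\<in>P \<rightarrow>\<^sub>E {..<r}. h (\<lambda>i. (\<tau> i + \<delta> i) mod r)) = (\<Sum>c\<in>P \<rightarrow>\<^sub>E {..<r}. h c)"
proof -
  let ?S = "P \<rightarrow>\<^sub>E {..<r}"
  let ?f = "\<lambda>\<delta>. restrict (\<lambda>i. (\<tau> i + \<delta> i) mod r) P"
  have inj: "inj_on ?f ?S"
  proof (rule inj_onI)
    fix \<delta> \<epsilon>
    assume mem: "\<delta> \<in> ?S" "\<epsilon> \<in> ?S" and eq: "?f \<delta> = ?f \<epsilon>"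
    show "\<delta> = \<epsilon>"
    proof (rule PiE_ext[OF mem])
      fix i
      assume i: "i \<in> P"
      then have "(\<tau> i + \<delta> i) mod r = (\<tau> i + \<epsilon> i) mod r"
        using fun_cong[OF eq, of i] by simp
      then show "\<delta> i = \<epsilon> i"
        using add_mod_cancel PiE_mem[OF mem(1) i] PiE_mem[OF mem(2) i] by blast
    qed
  qed
  have "?f ` ?S \<subseteq> ?S"
    by (auto simp: PiE_iff) (metis less_nat_zero_code mod_less_divisor neq0_conv)
  then have "bij_betw ?f ?S ?S"
    using inj \<open>finite P\<close> by (intro bij_betw_imageI endo_inj_surj finite_PiE) auto
  then have "(\<Sum>c\<in>?S. h c) = (\<Sum>\<delta>\<in>?S. h (?f \<delta>))"
    by (rule sum.reindex_bij_betw[symmetric])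
  also have "\<dots> = (\<Sum>\<delta>\<in>?S. h (\<lambda>i. (\<tau> i + \<delta> i) mod r))"
    by (intro sum.cong refl depends_onD[OF local]) simp
  finally show ?thesis ..
qed

lemma finite_color_fibre: "finite X \<Longrightarrow> finite {\<tau>. (\<omega>, \<tau>) \<in> X}"
  by (rule finite_subset[of _ "snd ` X"]) force+

text \<open>The sum over the fibre is unchanged by each shift \<open>\<delta>\<close>. Summing over
  all shifts and exchanging the sums, every \<open>\<tau>\<close> contributes the full sum of
  \<open>h\<close> over color vectors.\<close>

lemma sum_color_fibre:
  fixes h :: "(nat \<Rightarrow> nat) \<Rightarrow> real"
  assumes local: "depends_on P h" and P: "finite P"
    and shifts: "shifts_colors r P X"
  shows "real (r ^ card P) * (\<Sum>\<tau> | (\<omega>, \<tau>) \<in> X. h \<tau>) =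
           real (card {\<tau>. (\<omega>, \<tau>) \<in> X}) * (\<Sum>c\<in>P \<rightarrow>\<^sub>E {..<r}. h c)"
proof -
  let ?F = "{\<tau>. (\<omega>, \<tau>) \<in> X}" and ?S = "P \<rightarrow>\<^sub>E {..<r}"
  have "(\<Sum>\<tau>\<in>?F. h \<tau>) = (\<Sum>\<tau>\<in>?F. h (\<lambda>i. (\<tau> i + \<delta> i) mod r))" if \<delta>: "\<delta> \<in> ?S" for \<delta>
  proof -
    obtain \<phi> where \<phi>: "bij_betw \<phi> ?F ?F"
      "\<And>\<tau> i. \<tau> \<in> ?F \<Longrightarrow> i \<in> P \<Longrightarrow> \<phi> \<tau> i = (\<tau> i + \<delta> i) mod r"
      using shifts \<delta> unfolding shifts_colors_def by blast
    have "(\<Sum>\<tau>\<in>?F. h \<tau>) = (\<Sum>\<tau>\<in>?F. h (\<phi> \<tau>))"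
      using \<phi>(1) by (rule sum.reindex_bij_betw[symmetric])
    also have "\<dots> = (\<Sum>\<tau>\<in>?F. h (\<lambda>i. (\<tau> i + \<delta> i) mod r))"
      using \<phi>(2) by (intro sum.cong refl depends_onD[OF local]) auto
    finally show ?thesis .
  qed
  then have "(\<Sum>\<delta>\<in>?S. \<Sum>\<tau>\<in>?F. h \<tau>) = (\<Sum>\<delta>\<in>?S. \<Sum>\<tau>\<in>?F. h (\<lambda>i. (\<tau> i + \<delta> i) mod r))"
    by (rule sum.cong[OF refl])
  also have "\<dots> = (\<Sum>\<tau>\<in>?F. \<Sum>c\<in>?S. h c)"
    by (subst sum.swap) (simp add: sum_shift_colors[OF local P])
  finally show ?thesis
    using P by (simp add: card_PiE)
qed

definition local_term :: "nat set \<Rightarrow> ((nat \<Rightarrow> nat) \<Rightarrow> real) \<Rightarrow> colored_perm \<Rightarrow> real" where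
  "local_term D h = (\<lambda>(\<omega>, \<tau>). of_bool (ascends D \<omega>) * h \<tau>)"

text \<open>The ascent indicator is constant on each fibre over \<open>\<omega>\<close>, so the
  color average factors out fibre by fibre.\<close>

lemma sum_local_term_colors:
  assumes local: "depends_on P h" and P: "finite P"
    and X: "finite X" and shifts: "shifts_colors r P X"
  shows "real (r ^ card P) * (\<Sum>x\<in>X. local_term D h x) =
           real (card {x \<in> X. ascends D (fst x)}) * (\<Sum>c\<in>P \<rightarrow>\<^sub>E {..<r}. h c)"
proof -
  let ?F = "\<lambda>\<omega>. {\<tau>. (\<omega>, \<tau>) \<in> X}" and ?H = "\<Sum>c\<in>P \<rightarrow>\<^sub>E {..<r}. h c"
  let ?a = "\<lambda>\<omega>. of_bool (ascends D \<omega>) :: real"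
  have sum_X: "(\<Sum>x\<in>X. f x) = (\<Sum>\<omega>\<in>fst ` X. \<Sum>\<tau>\<in>?F \<omega>. f (\<omega>, \<tau>))"
    for f :: "colored_perm \<Rightarrow> real"
  proof -
    have "X = Sigma (fst ` X) ?F"
      by force
    then show ?thesis
      using sum.Sigma[of "fst ` X" ?F "\<lambda>\<omega> \<tau>. f (\<omega>, \<tau>)"] X finite_color_fibre[OF X] by simp
  qed
  have "real (r ^ card P) * (\<Sum>x\<in>X. local_term D h x) =
      (\<Sum>\<omega>\<in>fst ` X. ?a \<omega> * (real (r ^ card P) * (\<Sum>\<tau>\<in>?F \<omega>. h \<tau>)))"
    by (simp add: sum_X local_term_def sum_distrib_left mult_ac)
  also have "\<dots> = (\<Sum>\<omega>\<in>fst ` X. \<Sum>\<tau>\<in>?F \<omega>. ?a \<omega>) * ?H"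
    unfolding sum_color_fibre[OF local P shifts] sum_distrib_right[where r = ?H]
    by (intro sum.cong refl) simp
  also have "(\<Sum>\<omega>\<in>fst ` X. \<Sum>\<tau>\<in>?F \<omega>. ?a \<omega>) = (\<Sum>x\<in>X. ?a (fst x))"
    by (simp add: sum_X)
  also have "\<dots> = real (card {x \<in> X. ascends D (fst x)})"
    using X by (simp add: of_bool_def sum.If_cases Int_def)
  finally show ?thesis .
qed

section \<open>Color shifts and ascent counts in the whole group\<close>

text \<open>Count the pairs \<open>(y, x)\<close> with \<open>Q (\<psi> y x)\<close> twice: each
  \<open>y\<close> gives as many as there are solutions of \<open>Q\<close>, each \<open>x\<close>
  gives one. No group action is required.\<close>

lemma card_sorted:
  assumes "finite X" "finite Y" and bij: "\<And>y. y \<in> Y \<Longrightarrow> bij_betw (\<psi> y) X X"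
    and ex1: "\<And>x. x \<in> X \<Longrightarrow> \<exists>!y. y \<in> Y \<and> Q (\<psi> y x)"
  shows "card Y * card {x \<in> X. Q x} = card X"
proof -
  have count: "card {x \<in> X. Q x} = card {x \<in> X. Q (\<psi> y x)}" if "y \<in> Y" for y
  proof -
    have "bij_betw (\<psi> y) {x \<in> X. Q (\<psi> y x)} {x \<in> X. Q x}"
      using bij[OF that] by (auto simp: bij_betw_def inj_on_def)
    then show ?thesis
      by (simp add: bij_betw_same_card)
  qed
  have one: "card {y \<in> Y. Q (\<psi> y x)} = 1" if x: "x \<in> X" for x
  proof -
    obtain y where "{y \<in> Y. Q (\<psi> y x)} = {y}"
      using ex1[OF x] by blast
    then show ?thesis
      by simp
  qed
  have "card Y * card {x \<in> X. Q x} = (\<Sum>y\<in>Y. card {x \<in> X. Q x})"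
    by simp
  also have "\<dots> = (\<Sum>y\<in>Y. card {x \<in> X. Q (\<psi> y x)})"
    by (rule sum.cong[OF refl count])
  also have "\<dots> = (\<Sum>x\<in>X. card {y \<in> Y. Q (\<psi> y x)})"
    using sum_multicount_gen[of Y X "\<lambda>y x. Q (\<psi> y x)" "\<lambda>x. card {y \<in> Y. Q (\<psi> y x)}"] assms(1,2)
    by simp
  also have "\<dots> = card X"
    using one by simp
  finally show ?thesis .
qed

text \<open>An injective self-map of a finite fibre is bijective. Empty fibres are trivial, so
  \<open>\<omega>\<close> may be taken to occur in \<open>X\<close>.\<close>

lemma shifts_colorsI:
  assumes "finite X"
    and "\<And>\<omega> \<delta>. {\<tau>. (\<omega>, \<tau>) \<in> X} \<noteq> {} \<Longrightarrow> \<delta> \<in> P \<rightarrow>\<^sub>E {..<r} \<Longrightarrow> \<exists>\<phi>.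
      inj_on \<phi> {\<tau>. (\<omega>, \<tau>) \<in> X} \<and> (\<forall>\<tau>. (\<omega>, \<tau>) \<in> X \<longrightarrow> (\<omega>, \<phi> \<tau>) \<in> X) \<and>
      (\<forall>\<tau>. (\<omega>, \<tau>) \<in> X \<longrightarrow> (\<forall>i\<in>P. \<phi> \<tau> i = (\<tau> i + \<delta> i) mod r))"
  shows "shifts_colors r P X"
  unfolding shifts_colors_def
proof (intro allI ballI)
  fix \<omega> \<delta>
  let ?F = "{\<tau>. (\<omega>, \<tau>) \<in> X}"
  assume \<delta>: "\<delta> \<in> P \<rightarrow>\<^sub>E {..<r}"
  show "\<exists>\<phi>. bij_betw \<phi> ?F ?F \<and>
      (\<forall>\<tau>. (\<omega>, \<tau>) \<in> X \<longrightarrow> (\<forall>i\<in>P. \<phi> \<tau> i = (\<tau> i + \<delta> i) mod r))"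
  proof (cases "?F = {}")
    case True
    then show ?thesis
      by (auto simp: bij_betw_def)
  next
    case False
    then obtain \<phi> where \<phi>: "inj_on \<phi> ?F" "\<forall>\<tau>. (\<omega>, \<tau>) \<in> X \<longrightarrow> (\<omega>, \<phi> \<tau>) \<in> X"
      "\<forall>\<tau>. (\<omega>, \<tau>) \<in> X \<longrightarrow> (\<forall>i\<in>P. \<phi> \<tau> i = (\<tau> i + \<delta> i) mod r)"
      using assms(2)[OF False \<delta>] by blast
    then have "bij_betw \<phi> ?F ?F"
      by (intro bij_betw_imageI endo_inj_surj finite_color_fibre[OF assms(1)]) auto
    with \<phi>(3) show ?thesis
      by blast
  qed
qed

lemma shifts_colors_colored_perms:
  assumes P: "P \<subseteq> {1..n}"
  shows "shifts_colors r P (colored_perms n r)"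
proof (rule shifts_colorsI[OF finite_colored_perms])
  fix \<omega> \<delta>
  let ?X = "colored_perms n r"
  let ?F = "{\<tau>. (\<omega>, \<tau>) \<in> ?X}"
  define \<phi> where "\<phi> \<tau> i = (if i \<in> P then (\<tau> i + \<delta> i) mod r else \<tau> i)" for \<tau> :: "nat \<Rightarrow> nat" and i
  have "inj_on \<phi> ?F"
  proof (intro inj_onI ext)
    fix \<tau> \<tau>' i
    assume \<tau>: "\<tau> \<in> ?F" "\<tau>' \<in> ?F" and eq: "\<phi> \<tau> = \<phi> \<tau>'"
    show "\<tau> i = \<tau>' i"
    proof (cases "i \<in> P")
      case True
      then show ?thesis
        using add_mod_cancel[of "\<tau> i" r "\<tau>' i" "\<delta> i"] fun_cong[OF eq, of i] \<tau> P
        by (auto simp: \<phi>_def colored_perms_def add.commute)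
    next
      case False
      then show ?thesis
        using fun_cong[OF eq, of i] by (simp add: \<phi>_def)
    qed
  qed
  moreover have "(\<omega>, \<phi> \<tau>) \<in> ?X" if "(\<omega>, \<tau>) \<in> ?X" for \<tau>
    using that P by (auto simp: \<phi>_def colored_perms_def Ball_def intro!: mod_less_divisor)
  moreover have "\<forall>i\<in>P. \<phi> \<tau> i = (\<tau> i + \<delta> i) mod r" for \<tau>
    by (simp add: \<phi>_def)
  ultimately show "\<exists>\<phi>. inj_on \<phi> ?F \<and> (\<forall>\<tau>. (\<omega>, \<tau>) \<in> ?X \<longrightarrow> (\<omega>, \<phi> \<tau>) \<in> ?X) \<and>
      (\<forall>\<tau>. (\<omega>, \<tau>) \<in> ?X \<longrightarrow> (\<forall>i\<in>P. \<phi> \<tau> i = (\<tau> i + \<delta> i) mod r))"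
    by blast
qed

text \<open>The map \<open>\<psi>\<close> leaves \<open>\<tau>\<close> in place, because only
  \<open>\<omega>\<close> enters the count.\<close>

lemma card_ascending_colored_perms:
  assumes "D \<subseteq> {1..n}" "Suc ` D \<subseteq> {1..n}"
  shows "card (block_perms n (block D)) * card {x \<in> colored_perms n r. ascends D (fst x)} =
           card (colored_perms n r)"
proof (rule card_sorted[where \<psi> = "\<lambda>y (\<omega>, \<tau>). (\<omega> \<circ> pinv y, \<tau>)"])
  let ?X = "colored_perms n r"
  fix y :: "nat \<Rightarrow> nat"
  let ?\<psi> = "\<lambda>(\<omega>, \<tau>). (\<omega> \<circ> pinv y, \<tau>)"
  assume "y \<in> block_perms n (block D)"
  then have y: "y permutes {1..n}"
    by (simp add: block_perms_def)
  have "inj_on ?\<psi> ?X"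
  proof (rule inj_onI, clarsimp)
    fix \<omega> \<omega>'
    assume "\<omega> \<circ> pinv y = \<omega>' \<circ> pinv y"
    then have "\<omega> \<circ> pinv y \<circ> y = \<omega>' \<circ> pinv y \<circ> y"
      by simp
    then show "\<omega> = \<omega>'"
      by (simp add: comp_assoc permutes_inv_o(2)[OF y])
  qed
  moreover have "?\<psi> ` ?X \<subseteq> ?X"
    using permutes_compose[OF permutes_inv[OF y]] by (auto simp: colored_perms_def)
  ultimately show "bij_betw ?\<psi> ?X ?X"
    by (intro bij_betw_imageI endo_inj_surj finite_colored_perms)
next
  fix x
  assume "x \<in> colored_perms n r"
  then show "\<exists>!y. y \<in> block_perms n (block D) \<and>
      ascends D (fst ((\<lambda>(\<omega>, \<tau>). (\<omega> \<circ> pinv y, \<tau>)) x))"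
    using ex1_ascends_comp[OF _ assms, of "fst x"] by (auto simp: colored_perms_def)
qed (rule finite_colored_perms finite_block_perms)+

section \<open>Color shifts and ascent counts under conjugation\<close>

text \<open>The equation \<open>z g = g y\<close> expresses \<open>z = g y g\<^sup>-\<^sup>1\<close> without inverses.\<close>

definition conj_closed :: "nat \<Rightarrow> nat \<Rightarrow> colored_perm set \<Rightarrow> bool" where
  "conj_closed n r X \<longleftrightarrow> X \<subseteq> colored_perms n r \<and>
     (\<forall>g\<in>colored_perms n r. \<forall>y\<in>colored_perms n r. \<forall>z\<in>colored_perms n r.
        colored_mult r z g = colored_mult r g y \<longrightarrow> (y \<in> X \<longleftrightarrow> z \<in> X))"

lemma (in group) conjugate_in_conjugacy_class:
  assumes "x \<in> carrier G" "y \<in> conjugacy_class G x" "g \<in> carrier G"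
  shows "g \<otimes> y \<otimes> inv g \<in> conjugacy_class G x"
proof -
  obtain h where h: "h \<in> carrier G" "y = h \<otimes> x \<otimes> inv h"
    using assms(2) by (auto simp: conjugacy_class_def)
  have "g \<otimes> y \<otimes> inv g = (g \<otimes> h) \<otimes> x \<otimes> inv (g \<otimes> h)"
    using h assms by (simp add: inv_mult_group m_assoc)
  then show ?thesis
    using h assms(3) by (auto simp: conjugacy_class_def)
qed

lemma (in group) conjugacy_class_iff:
  assumes "x \<in> carrier G" and gyz: "g \<in> carrier G" "y \<in> carrier G" "z \<in> carrier G"
    and "z \<otimes> g = g \<otimes> y"
  shows "y \<in> conjugacy_class G x \<longleftrightarrow> z \<in> conjugacy_class G x"
proof -
  have "z = g \<otimes> y \<otimes> inv g"
    using assms by (metis inv_solve_right m_closed)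
  moreover have "y = inv g \<otimes> z \<otimes> inv (inv g)"
    using assms by (metis inv_closed inv_inv inv_solve_left m_assoc m_closed)
  ultimately show ?thesis
    using conjugate_in_conjugacy_class assms(1) gyz inv_closed by metis
qed

lemma conj_closed_conjugacy_class:
  assumes "r > 0" "x \<in> colored_perms n r"
  shows "conj_closed n r (conjugacy_class (colored_perm_group n r) x)"
proof -
  let ?G = "colored_perm_group n r"
  interpret group ?G
    using assms(1) by (rule group_colored_perm_group)
  have G: "carrier ?G = colored_perms n r" "a \<otimes>\<^bsub>?G\<^esub> b = colored_mult r a b" for a b
    by (simp_all add: colored_perm_group_def)
  have "conjugacy_class ?G x \<subseteq> carrier ?G"
    using assms(2) by (auto simp: conjugacy_class_def simp flip: G(1))
  then show ?thesis
    using conjugacy_class_iff[of x] assms(2) unfolding conj_closed_def G by blast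
qed

text \<open>Conjugation by \<open>(id, \<rho>)\<close> fixes \<open>\<omega>\<close> and can add
  \<open>\<rho> i - \<rho> (\<omega> i)\<close> to the color of \<open>i\<close>. This difference
  has to be \<open>\<delta> i\<close> on \<open>P\<close>; summing \<open>\<delta>\<close> along the
  path of \<open>i\<close> up to its exit from \<open>P\<close> solves the recursion, which on a
  cycle inside \<open>P\<close> could be inconsistent.\<close>

lemma shifts_colors_conj_closed:
  assumes r: "r > 0" and X: "conj_closed n r X"
    and leaves: "\<And>x. x \<in> X \<Longrightarrow> leaves n P (fst x)" and P: "P \<subseteq> {1..n}"
  shows "shifts_colors r P X"
proof (rule shifts_colorsI)
  have X_sub: "X \<subseteq> colored_perms n r"
    using X by (simp add: conj_closed_def)
  then show "finite X"
    using finite_colored_perms finite_subset by blast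
  fix \<omega> \<delta>
  let ?F = "{\<tau>. (\<omega>, \<tau>) \<in> X}" and ?A = "{1..n}"
  assume "?F \<noteq> {}"
  then have \<omega>: "\<omega> permutes ?A" and leaves_\<omega>: "leaves n P \<omega>"
    using X_sub leaves by (force simp: colored_perms_def)+
  \<comment> \<open>For \<open>i\<close> outside \<open>P\<close> the exit time is \<open>0\<close>,
    hence \<open>\<rho> i = 0\<close>.\<close>
  define exit where "exit i = (LEAST t. (\<omega> ^^ t) i \<notin> P)" for i
  define \<rho> where "\<rho> i = (if i \<in> ?A then (\<Sum>s<exit i. \<delta> ((\<omega> ^^ s) i)) mod r else 0)" for i
  have \<rho>_less: "\<rho> i < r" for i
    using r by (simp add: \<rho>_def)
  have \<rho>_step: "\<rho> i = (\<delta> i + \<rho> (\<omega> i)) mod r" if i: "i \<in> P" for i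
  proof -
    have A: "i \<in> ?A" "\<omega> i \<in> ?A"
      using i P permutes_in_image[OF \<omega>] by blast+
    obtain t where "(\<omega> ^^ t) i \<notin> P"
      using leaves_\<omega> A(1) unfolding leaves_def by blast
    then have "exit i = Suc (LEAST t. (\<omega> ^^ Suc t) i \<notin> P)"
      unfolding exit_def by (rule Least_Suc) (simp add: i)
    then have "exit i = Suc (exit (\<omega> i))"
      by (simp add: exit_def funpow_swap1)
    then show ?thesis
      using A by (simp add: \<rho>_def sum.lessThan_Suc_shift funpow_swap1 mod_simps del: sum.lessThan_Suc)
  qed
  \<comment> \<open>The term \<open>r - \<rho> (\<omega> i)\<close> is the negative of
    \<open>\<rho> (\<omega> i)\<close> modulo \<open>r\<close>, kept within the natural
    numbers.\<close>
  define \<phi> where "\<phi> \<tau> i = (if i \<in> ?A then (\<rho> i + (r - \<rho> (\<omega> i)) + \<tau> i) mod r else 0)"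
    for \<tau> :: "nat \<Rightarrow> nat" and i
  have "(\<omega>, \<phi> \<tau>) \<in> X" if "(\<omega>, \<tau>) \<in> X" for \<tau>
  proof -
    have \<tau>: "\<tau> i = 0" if "i \<notin> ?A" for i
      using X_sub \<open>(\<omega>, \<tau>) \<in> X\<close> that unfolding colored_perms_def by blast
    have "(id, \<rho>) \<in> colored_perms n r" "(\<omega>, \<phi> \<tau>) \<in> colored_perms n r"
      using \<omega> r by (auto simp: colored_perms_def permutes_id \<rho>_def \<phi>_def)
    moreover have "colored_mult r (\<omega>, \<tau>) (id, \<rho>) = colored_mult r (id, \<rho>) (\<omega>, \<phi> \<tau>)"
    proof -
      have "(\<tau> i + \<rho> i) mod r = (\<rho> (\<omega> i) + \<phi> \<tau> i) mod r" for i
      proof (cases "i \<in> ?A")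
        case True
        have "\<rho> (\<omega> i) + (\<rho> i + (r - \<rho> (\<omega> i)) + \<tau> i) = \<tau> i + \<rho> i + r"
          using \<rho>_less[of "\<omega> i"] by simp
        then show ?thesis
          using True unfolding \<phi>_def by (simp only: mod_add_right_eq mod_add_self2 if_True)
      next
        case False
        then show ?thesis
          using \<tau>[OF False] permutes_not_in[OF \<omega> False] unfolding \<phi>_def \<rho>_def
          by (simp only: False if_False)
      qed
      then show ?thesis
        by (simp add: colored_mult_def)
    qed
    ultimately show ?thesis
      using X that X_sub unfolding conj_closed_def by blast
  qed
  moreover have "inj_on \<phi> ?F"
  proof (intro inj_onI ext)
    fix \<tau> \<tau>' i
    assume "\<tau> \<in> ?F" "\<tau>' \<in> ?F" and eq: "\<phi> \<tau> = \<phi> \<tau>'"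
    then have \<tau>: "(\<omega>, \<tau>) \<in> colored_perms n r" "(\<omega>, \<tau>') \<in> colored_perms n r"
      using X_sub by auto
    show "\<tau> i = \<tau>' i"
    proof (cases "i \<in> ?A")
      case True
      then show ?thesis
        using add_mod_cancel[of "\<tau> i" r "\<tau>' i" "\<rho> i + (r - \<rho> (\<omega> i))"] fun_cong[OF eq, of i] \<tau>
        by (auto simp: \<phi>_def colored_perms_def)
    next
      case False
      then show ?thesis
        using \<tau> by (auto simp: colored_perms_def)
    qed
  qed
  moreover have "\<phi> \<tau> i = (\<tau> i + \<delta> i) mod r" if i: "i \<in> P" for \<tau> i
  proof -
    have "\<delta> i + \<rho> (\<omega> i) + (r - \<rho> (\<omega> i) + \<tau> i) = \<tau> i + \<delta> i + r"
      using \<rho>_less[of "\<omega> i"] by simp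
    moreover have "\<phi> \<tau> i = ((\<delta> i + \<rho> (\<omega> i)) mod r + (r - \<rho> (\<omega> i) + \<tau> i)) mod r"
      using i P \<rho>_step[OF i] by (auto simp: \<phi>_def add.assoc)
    ultimately have "\<phi> \<tau> i = (\<tau> i + \<delta> i + r) mod r"
      by (simp only: mod_add_left_eq)
    then show ?thesis
      by simp
  qed
  ultimately show "\<exists>\<phi>. inj_on \<phi> ?F \<and> (\<forall>\<tau>. (\<omega>, \<tau>) \<in> X \<longrightarrow> (\<omega>, \<phi> \<tau>) \<in> X) \<and>
      (\<forall>\<tau>. (\<omega>, \<tau>) \<in> X \<longrightarrow> (\<forall>i\<in>P. \<phi> \<tau> i = (\<tau> i + \<delta> i) mod r))"
    by blast
qed

text \<open>Here \<open>\<psi> y\<close> is conjugation by the uncolored element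
  \<open>(y, \<lambda>_. 0)\<close>, which carries the colors along with the positions and so stays
  in \<open>X\<close>.\<close>

lemma card_ascending_conj_closed:
  assumes r: "r > 0" and X: "conj_closed n r X"
    and leaves: "\<And>x. x \<in> X \<Longrightarrow> leaves n P (fst x)" and P: "P \<subseteq> {1..n}"
    and D: "D \<subseteq> P" "Suc ` D \<subseteq> P"
  shows "card (block_perms n (block D)) * card {x \<in> X. ascends D (fst x)} = card X"
proof (rule card_sorted[where \<psi> = "\<lambda>y (\<omega>, \<tau>). (y \<circ> \<omega> \<circ> pinv y, \<tau> \<circ> pinv y)"])
  have X_sub: "X \<subseteq> colored_perms n r"
    using X by (simp add: conj_closed_def)
  then show fin: "finite X"
    using finite_colored_perms finite_subset by blast
  show "finite (block_perms n (block D))"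
    by (rule finite_block_perms)
  show "\<exists>!y. y \<in> block_perms n (block D) \<and>
      ascends D (fst ((\<lambda>(\<omega>, \<tau>). (y \<circ> \<omega> \<circ> pinv y, \<tau> \<circ> pinv y)) x))" if x: "x \<in> X" for x
  proof -
    have "fst x permutes {1..n}"
      using x X_sub by (auto simp: colored_perms_def)
    from ex1_ascends_conj[OF this P D leaves[OF x]] show ?thesis
      by (simp add: case_prod_beta)
  qed
  fix y :: "nat \<Rightarrow> nat"
  let ?\<psi> = "\<lambda>(\<omega>, \<tau>). (y \<circ> \<omega> \<circ> pinv y, \<tau> \<circ> pinv y)"
  assume "y \<in> block_perms n (block D)"
  then have y: "y permutes {1..n}"
    by (simp add: block_perms_def)
  note y_inv = permutes_inverses[OF y]
  have "inj_on ?\<psi> X"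
  proof (rule inj_onI, clarsimp)
    fix \<omega> \<tau> \<omega>' \<tau>'
    assume eq: "y \<circ> \<omega> \<circ> pinv y = y \<circ> \<omega>' \<circ> pinv y" "\<tau> \<circ> pinv y = \<tau>' \<circ> pinv y"
    have "\<omega> i = \<omega>' i" for i
      using fun_cong[OF eq(1), of "y i"] permutes_inj[OF y] by (simp add: y_inv inj_eq)
    moreover have "\<tau> i = \<tau>' i" for i
      using fun_cong[OF eq(2), of "y i"] by (simp add: y_inv)
    ultimately show "\<omega> = \<omega>' \<and> \<tau> = \<tau>'"
      by blast
  qed
  moreover have "?\<psi> (\<omega>, \<tau>) \<in> X" if x: "(\<omega>, \<tau>) \<in> X" for \<omega> \<tau>
  proof -
    have \<omega>\<tau>: "(\<omega>, \<tau>) \<in> colored_perms n r"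
      using x X_sub by blast
    have "(y, \<lambda>_. 0) \<in> colored_perms n r"
      using y r by (simp add: colored_perms_def)
    moreover have "?\<psi> (\<omega>, \<tau>) \<in> colored_perms n r"
      using \<omega>\<tau> permutes_in_image[OF permutes_inv[OF y]] permutes_inv[OF y] y
      by (auto simp: colored_perms_def permutes_compose simp del: atLeastAtMost_iff)
    moreover have "colored_mult r (?\<psi> (\<omega>, \<tau>)) (y, \<lambda>_. 0) = colored_mult r (y, \<lambda>_. 0) (\<omega>, \<tau>)"
      by (simp add: colored_mult_def y_inv fun_eq_iff)
    ultimately show ?thesis
      using X x \<omega>\<tau> unfolding conj_closed_def by blast
  qed
  then have "?\<psi> ` X \<subseteq> X"
    by auto
  ultimately show "bij_betw ?\<psi> X X"
    by (intro bij_betw_imageI endo_inj_surj fin)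
qed

section \<open>Conjugacy classes without short cycles\<close>

text \<open>A path that never leaves \<open>P\<close> has its whole cycle in \<open>P\<close>; the
  length of that cycle, at most \<open>m\<close>, would be a part of the partition indexed by its
  color.\<close>

lemma leaves_cycle_type_class:
  assumes r: "r > 0" and x: "x \<in> cycle_type_class n r \<Lambda>"
    and no_short: "\<forall>\<mu>\<in>set \<Lambda>. \<forall>l\<in>{1..m}. l \<notin># \<mu>"
    and P: "finite P" "card P \<le> m"
  shows "leaves n P (fst x)"
  unfolding leaves_def
proof
  obtain \<omega> \<tau> where x_eq: "x = (\<omega>, \<tau>)"
    by (cases x)
  fix i
  assume i: "i \<in> {1..n}"
  show "\<exists>t. (fst x ^^ t) i \<notin> P"
  proof (rule ccontr)
    assume "\<not> ?thesis"
    then have c_sub: "orbit \<omega> i \<subseteq> P"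
      by (auto simp: orbit_altdef x_eq)
    let ?c = "orbit \<omega> i"
    define j where "j = cycle_color r \<tau> ?c"
    define \<mu> where "\<mu> = image_mset card (mset_set {c \<in> cycles n \<omega>. cycle_color r \<tau> c = j})"
    have "finite (cycles n \<omega>)" "?c \<in> cycles n \<omega>"
      using i by (auto simp: cycles_def)
    then have "card ?c \<in># \<mu>"
      by (auto simp: \<mu>_def j_def)
    moreover have "\<mu> \<in> set \<Lambda>"
    proof -
      have "j < r"
        using r by (simp add: j_def cycle_color_def)
      moreover have "\<Lambda> = cycle_type n r x"
        using x by (simp add: cycle_type_class_def)
      ultimately show ?thesis
        by (auto simp: cycle_type_def x_eq \<mu>_def)
    qed
    moreover have "card ?c \<in> {1..m}"
    proof -
      \<comment> \<open>An \<open>orbit\<close> is generated from the first iterate on, so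
        \<open>\<omega> i\<close> is the immediate witness that it is nonempty.\<close>
      have "\<omega> i \<in> ?c" "finite ?c"
        using c_sub P(1) by (auto intro: orbit.base finite_subset)
      then have "card ?c > 0"
        by (auto simp: card_gt_0_iff)
      then show ?thesis
        using card_mono[OF P(1) c_sub] P(2) by simp
    qed
    ultimately show False
      using no_short by blast
  qed
qed

section \<open>Expectations of local terms\<close>

lemma uniform_expectation_eq:
  assumes "finite X" "X \<noteq> {}"
  shows "uniform_expectation X f = sum f X / real (card X)"
  using assms by (simp add: uniform_expectation_def integral_pmf_of_set)

text \<open>The common interface of the class and the whole group: color uniformity and the ascent
  count on every set of at most \<open>m\<close> positions.\<close>

definition equidistributed :: "nat \<Rightarrow> nat \<Rightarrow> nat \<Rightarrow> colored_perm set \<Rightarrow> bool" where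
  "equidistributed n r m X \<longleftrightarrow> X \<subseteq> colored_perms n r \<and> X \<noteq> {} \<and>
     (\<forall>P\<subseteq>{1..n}. card P \<le> m \<longrightarrow> shifts_colors r P X \<and>
       (\<forall>D. D \<subseteq> P \<longrightarrow> Suc ` D \<subseteq> P \<longrightarrow>
         card (block_perms n (block D)) * card {x \<in> X. ascends D (fst x)} = card X))"

lemma equidistributedD:
  assumes "equidistributed n r m X"
  shows "finite X" "X \<noteq> {}" "X \<subseteq> colored_perms n r"
  using assms finite_subset[OF _ finite_colored_perms] by (auto simp: equidistributed_def)

lemma equidistributed_colored_perms:
  assumes "r > 0"
  shows "equidistributed n r m (colored_perms n r)"
proof -
  have "(id, \<lambda>_. 0) \<in> colored_perms n r"
    using assms by (simp add: colored_perms_def permutes_id)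
  moreover have "card (block_perms n (block D)) * card {x \<in> colored_perms n r. ascends D (fst x)} =
      card (colored_perms n r)" if "D \<subseteq> P" "Suc ` D \<subseteq> P" "P \<subseteq> {1..n}" for D P
    using that by (intro card_ascending_colored_perms) auto
  ultimately show ?thesis
    using shifts_colors_colored_perms unfolding equidistributed_def by blast
qed

lemma equidistributed_cycle_type_class:
  assumes r: "r > 0" and X: "cycle_type_class n r \<Lambda> \<in> conjugacy_classes (colored_perm_group n r)"
    and no_short: "\<forall>\<mu>\<in>set \<Lambda>. \<forall>l\<in>{1..m}. l \<notin># \<mu>"
  shows "equidistributed n r m (cycle_type_class n r \<Lambda>)"
proof -
  let ?X = "cycle_type_class n r \<Lambda>" and ?G = "colored_perm_group n r"
  interpret group ?G
    using r by (rule group_colored_perm_group)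
  obtain x where x: "x \<in> carrier ?G" "?X = conjugacy_class ?G x"
    using X by (auto simp: conjugacy_classes_def)
  have "\<one>\<^bsub>?G\<^esub> \<otimes>\<^bsub>?G\<^esub> x \<otimes>\<^bsub>?G\<^esub> inv\<^bsub>?G\<^esub> \<one>\<^bsub>?G\<^esub> \<in> ?X"
    unfolding x(2) conjugacy_class_def by blast
  then have "?X \<noteq> {}"
    by blast
  moreover have closed: "conj_closed n r ?X"
    unfolding x(2) using r x(1) by (intro conj_closed_conjugacy_class) (simp_all add: colored_perm_group_def)
  moreover have leaves: "leaves n P (fst x)" if "P \<subseteq> {1..n}" "card P \<le> m" "x \<in> ?X" for P x
    using that leaves_cycle_type_class[OF r _ no_short] finite_subset by blast
  moreover have "shifts_colors r P ?X" if "P \<subseteq> {1..n}" "card P \<le> m" for P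
    using that by (intro shifts_colors_conj_closed[OF r closed leaves])
  moreover have "card (block_perms n (block D)) * card {x \<in> ?X. ascends D (fst x)} = card ?X"
    if "P \<subseteq> {1..n}" "card P \<le> m" "D \<subseteq> P" "Suc ` D \<subseteq> P" for P D
    using that by (intro card_ascending_conj_closed[OF r closed leaves])
  ultimately show ?thesis
    unfolding equidistributed_def conj_closed_def by blast
qed

text \<open>The point is that the value does not mention \<open>X\<close>: the color average and the
  ascent probability are the same for all equidistributed sets.\<close>

lemma expectation_local_term:
  assumes r: "r > 0" and X: "equidistributed n r m X" and P: "P \<subseteq> {1..n}" "card P \<le> m"
    and D: "D \<subseteq> P" "Suc ` D \<subseteq> P" and h: "depends_on P h"
  shows "uniform_expectation X (local_term D h) =
           (\<Sum>c\<in>P \<rightarrow>\<^sub>E {..<r}. h c) / (real (r ^ card P) * real (card (block_perms n (block D))))"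
proof -
  let ?H = "\<Sum>c\<in>P \<rightarrow>\<^sub>E {..<r}. h c" and ?B = "card (block_perms n (block D))"
  define N where "N = card {x \<in> X. ascends D (fst x)}"
  have fin: "finite X" "X \<noteq> {}" "finite P"
    using equidistributedD[OF X] finite_subset[OF P(1)] by auto
  have "shifts_colors r P X" and BN: "card X = ?B * N"
    using X P D unfolding equidistributed_def N_def by simp_all
  then have sum: "real (r ^ card P) * (\<Sum>x\<in>X. local_term D h x) = real N * ?H"
    using h fin unfolding N_def by (intro sum_local_term_colors)
  \<comment> \<open>Nonemptiness of \<open>X\<close> makes both factors positive, so
    \<open>N\<close> can be cancelled.\<close>
  have "?B * N > 0"
    unfolding BN[symmetric] using fin by (simp add: card_gt_0_iff)
  then show ?thesis
    using r sum unfolding uniform_expectation_eq[OF fin(1,2)] BN by (simp add: field_simps)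
qed

section \<open>The algebra of local statistics\<close>

text \<open>Scalars are absorbed into \<open>h\<close>. Rule \<open>cong\<close> asks for agreement
  on \<open>colored_perms n r\<close> only, because injectivity of \<open>\<omega>\<close> and the
  conventions at \<open>n + 1\<close> hold there.\<close>

inductive local_stat :: "nat \<Rightarrow> nat \<Rightarrow> nat \<Rightarrow> (colored_perm \<Rightarrow> real) \<Rightarrow> bool" for n r m where
  local_term: "P \<subseteq> {1..n} \<Longrightarrow> card P \<le> m \<Longrightarrow> D \<subseteq> P \<Longrightarrow> Suc ` D \<subseteq> P \<Longrightarrow> depends_on P h \<Longrightarrow>
    local_stat n r m (local_term D h)"
| add: "local_stat n r m F \<Longrightarrow> local_stat n r m G \<Longrightarrow> local_stat n r m (\<lambda>x. F x + G x)"
| cong: "local_stat n r m F \<Longrightarrow> (\<And>x. x \<in> colored_perms n r \<Longrightarrow> F x = G x) \<Longrightarrow> local_stat n r m G"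

lemma expectation_local_stat:
  assumes "local_stat n r m F" and r: "r > 0"
    and X: "equidistributed n r m X" and Y: "equidistributed n r m Y"
  shows "uniform_expectation X F = uniform_expectation Y F"
  using assms(1)
proof induction
  case (local_term P D h)
  then show ?case
    by (simp add: expectation_local_term[OF r X] expectation_local_term[OF r Y])
next
  case (add F G)
  have "uniform_expectation Z (\<lambda>x. F x + G x) = uniform_expectation Z F + uniform_expectation Z G"
    if "equidistributed n r m Z" for Z
  proof -
    show ?thesis
      using equidistributedD[OF that]
      by (simp add: uniform_expectation_eq sum.distrib add_divide_distrib)
  qed
  with X Y add.IH show ?case
    by simp
next
  case (cong F G)
  have "uniform_expectation Z F = uniform_expectation Z G" if "equidistributed n r m Z" for Z
  proof -
    have "sum F Z = sum G Z"
      using equidistributedD(3)[OF that] cong.hyps(2) by (intro sum.cong) auto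
    then show ?thesis
      using equidistributedD[OF that] by (simp add: uniform_expectation_eq)
  qed
  from this[OF X] this[OF Y] cong.IH show ?case
    by simp
qed

lemma local_stat_const: "local_stat n r m (\<lambda>_. c)"
proof -
  have "local_stat n r m (local_term {} (\<lambda>_. c))"
    by (rule local_stat.local_term[of "{}"]) (auto simp: depends_on_def)
  then show ?thesis
    by (rule local_stat.cong) (auto simp: local_term_def ascends_def)
qed

lemma local_stat_sum:
  assumes "\<And>i. i \<in> I \<Longrightarrow> local_stat n r m (F i)"
  shows "local_stat n r m (\<lambda>x. \<Sum>i\<in>I. F i x)"
  using assms
  by (induction I rule: infinite_finite_induct) (auto intro: local_stat_const local_stat.add)

text \<open>Ascent conditions on \<open>D\<close> and \<open>E\<close> combine to one on
  \<open>D \<union> E\<close>, and the supports \<open>P\<close> and \<open>Q\<close> to their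
  union; hence the bounds add.\<close>

lemma local_stat_mult:
  assumes "local_stat n r m F" and "local_stat n r m' G"
  shows "local_stat n r (m + m') (\<lambda>x. F x * G x)"
  using assms(1)
proof induction
  case F: (local_term P D h)
  show ?case
    using assms(2)
  proof induction
    case (local_term Q E g)
    have "depends_on (P \<union> Q) (\<lambda>\<tau>. h \<tau> * g \<tau>)"
      using F(5) local_term(5) unfolding depends_on_def by (metis UnCI)
    moreover have "card (P \<union> Q) \<le> m + m'"
      using card_Un_le[of P Q] F(2) local_term(2) by linarith
    ultimately have "local_stat n r (m + m') (local_term (D \<union> E) (\<lambda>\<tau>. h \<tau> * g \<tau>))"
      using F local_term by (intro local_stat.local_term[of "P \<union> Q"]) auto
    then show ?case
      by (rule local_stat.cong) (auto simp: local_term_def ascends_def ball_Un)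
  qed (auto simp: distrib_left intro: local_stat.add local_stat.cong)
qed (auto simp: distrib_right intro: local_stat.add local_stat.cong)

lemma local_stat_power:
  assumes "local_stat n r m F"
  shows "local_stat n r (m * k) (\<lambda>x. F x ^ k)"
proof (induction k)
  case (Suc k)
  then show ?case
    using local_stat_mult[OF assms Suc] by simp
qed (simp add: local_stat_const)

section \<open>Descents and flag major index as local statistics\<close>

lemma local_stat_color:
  assumes "i \<in> {1..n}"
  shows "local_stat n r 2 (\<lambda>(\<omega>, \<tau>). g (\<tau> i))"
proof -
  have "local_stat n r 2 (local_term {} (\<lambda>\<tau>. g (\<tau> i)))"
    using assms by (intro local_stat.local_term[of "{i}"]) (auto simp: depends_on_def)
  then show ?thesis
    by (simp add: local_term_def ascends_def)
qed

text \<open>For \<open>i < n\<close>, a descent means a drop in color, or equal colors without an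
  ascent of \<open>\<omega>\<close>. So its indicator is that of a weak drop in color minus that of
  equal colors with an ascent.\<close>

lemma local_stat_descent:
  assumes i: "i \<in> {1..n}"
  shows "local_stat n r 2 (\<lambda>x. c * of_bool (i \<in> descents n x))"
proof (cases "i = n")
  case True
  \<comment> \<open>At \<open>n\<close> the next letter is \<open>n + 1\<close> with color
    \<open>0\<close>, which exceeds every letter of color \<open>0\<close>; there is a descent
    exactly when the last color is nonzero.\<close>
  have "c * of_bool (0 < snd x n) = c * of_bool (i \<in> descents n x)" if "x \<in> colored_perms n r" for x
  proof -
    obtain \<omega> \<tau> where x: "x = (\<omega>, \<tau>)"
      by (cases x)
    have \<omega>: "\<omega> permutes {1..n}" and \<tau>: "\<tau> (Suc n) = 0"
      using that by (auto simp: x colored_perms_def)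
    have "\<omega> n \<in> {1..n}" "\<omega> (Suc n) = Suc n"
      using permutes_in_image[OF \<omega>] permutes_not_in[OF \<omega>] i True by auto
    then show ?thesis
      using i True \<tau> by (auto simp: x descents_def colored_less_def)
  qed
  then show ?thesis
    using local_stat.cong[OF local_stat_color[OF i, of r "\<lambda>t. c * of_bool (0 < t)"]] True
    by (simp add: case_prod_beta)
next
  case False
  let ?P = "{i, Suc i}"
  let ?le = "\<lambda>\<tau>. c * of_bool (\<tau> (Suc i) \<le> \<tau> i)" and ?eq = "\<lambda>\<tau>. - c * of_bool (\<tau> (Suc i) = \<tau> i)"
  have "local_stat n r 2 (local_term {} ?le)" "local_stat n r 2 (local_term {i} ?eq)"
    using i False by (intro local_stat.local_term[of ?P]; auto simp: depends_on_def)+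
  then have "local_stat n r 2 (\<lambda>x. local_term {} ?le x + local_term {i} ?eq x)"
    by (rule local_stat.add)
  then show ?thesis
  proof (rule local_stat.cong)
    fix x
    assume x_in: "x \<in> colored_perms n r"
    obtain \<omega> \<tau> where x: "x = (\<omega>, \<tau>)"
      by (cases x)
    have "inj \<omega>"
      using x_in permutes_inj by (auto simp: x colored_perms_def)
    then have "\<omega> i \<noteq> \<omega> (Suc i)"
      by (simp add: inj_eq)
    then show "local_term {} ?le x + local_term {i} ?eq x = c * of_bool (i \<in> descents n x)"
      using i by (auto simp: x local_term_def ascends_def descents_def colored_less_def)
  qed
qed

lemma local_stat_des: "local_stat n r 2 (\<lambda>x. real (des n x))"
proof -
  have des: "real (des n x) = (\<Sum>i\<in>{1..n}. 1 * of_bool (i \<in> descents n x))" for x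
  proof -
    have "descents n x = {i \<in> {1..n}. i \<in> descents n x}"
      by (auto simp: descents_def)
    then show ?thesis
      by (simp add: des_def of_bool_def sum.If_cases Int_def)
  qed
  show ?thesis
    unfolding des by (intro local_stat_sum local_stat_descent)
qed

lemma local_stat_fmaj: "local_stat n r 2 (\<lambda>x. real (fmaj n r x))"
proof -
  have maj: "real (r * maj n x) = (\<Sum>i\<in>{1..n - 1}. real (r * i) * of_bool (i \<in> descents n x))" for x
  proof -
    have "(\<Sum>i\<in>{1..n - 1} \<inter> descents n x. real (r * i)) =
        (\<Sum>i\<in>{1..n - 1}. if i \<in> descents n x then real (r * i) else 0)"
      by (rule sum.inter_restrict) simp
    also have "\<dots> = (\<Sum>i\<in>{1..n - 1}. real (r * i) * of_bool (i \<in> descents n x))"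
      by (rule sum.cong) auto
    finally show ?thesis
      by (simp add: maj_def sum_distrib_left Int_commute[of "descents n x"])
  qed
  have col: "real (col n x) = (\<Sum>i\<in>{1..n}. case x of (\<omega>, \<tau>) \<Rightarrow> real (\<tau> i))" for x
    by (simp add: col_def case_prod_beta)
  show ?thesis
    unfolding fmaj_def of_nat_add maj col
    by (intro local_stat.add local_stat_sum local_stat_descent local_stat_color) auto
qed

theorem theorem1p1:
  fixes n r k :: nat and \<Lambda> :: "nat multiset list"
  assumes "n > 0" and "r > 0" and "k > 0"
    and "cycle_type_class n r \<Lambda> \<in> conjugacy_classes (colored_perm_group n r)"
    and "\<forall>\<mu>\<in>set \<Lambda>. \<forall>l\<in>{1..2 * k}. l \<notin># \<mu>"
  shows "uniform_expectation (cycle_type_class n r \<Lambda>) (\<lambda>x. real (des n x) ^ k) =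
           uniform_expectation (colored_perms n r) (\<lambda>x. real (des n x) ^ k) \<and>
         uniform_expectation (cycle_type_class n r \<Lambda>) (\<lambda>x. real (fmaj n r x) ^ k) =
           uniform_expectation (colored_perms n r) (\<lambda>x. real (fmaj n r x) ^ k)"
  \<comment> \<open>Each statistic involves two positions per term, so its \<open>k\<close>-th power
    has bound \<open>2 * k\<close>, matching the excluded cycle lengths.\<close>
  using expectation_local_stat[OF local_stat_power[OF local_stat_des] assms(2)
      equidistributed_cycle_type_class[OF assms(2,4,5)] equidistributed_colored_perms[OF assms(2)]]
    expectation_local_stat[OF local_stat_power[OF local_stat_fmaj] assms(2)
      equidistributed_cycle_type_class[OF assms(2,4,5)] equidistributed_colored_perms[OF assms(2)]]
  by blast

end
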